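(* Let $0\ge z_1\ge z_2\ge\dots\ge z_n$ be real numbers and let $y_0=(\eta_1,\dots,\eta_n)^T\in\mathbb{R}^n$ have components of equal absolute value, $|\eta_1|=\dots=|\eta_n|$. Suppose there exist $i\ne j$ such that $z_i\ne z_j$, $z_i\neq1$, $z_j\ne1$ and $\eta_i\eta_j\ne0$. Let $(\alpha,\beta)\in\mathbb{R}^2$ be the minimizer over $(\alpha',\beta')\in\mathbb{R}^2$ of $$\sum_{i=1}^n\eta_i^2\bigl(1+(z_i-1)(\alpha'+\beta'z_i)\bigr)^2,$$ and let $R(z)=\alpha+\beta z$. Then $|R(z_i)|\le1$ for all $i=1,\dots,n$ in each of the following cases: (i) $n\le415$; (ii) $n>415$ and $z_n\le10-\sqrt n$.
   Context: The minimal residual Euler (MRE) method for $y'=f(t,y)$ with step $\tau>0$ is $y_1=\alpha y_0+\tau\beta f(t_0,y_0)$, where $(\alpha,\beta)$ minimize the norm (here the 2-norm) of the implicit Euler residual $r_1(x)=y_0+\tau f(t_0+\tau,x)-x$ at $x=y_1$. Applied to the linear system $y'=\Lambda y$, $\Lambda=\operatorname{diag}\{\lambda_1,\dots,\lambda_n\}$, $y(0)=y_0=(\eta_1,\dots,\eta_n)^T$, with $z_i=\tau\lambda_i$, it gives $y_1=R(\tau\Lambda)y_0$ with $R(z)=\alpha+\beta z$, and $r_1(y_1)=P(\tau\Lambda)y_0$ with $P(z)=1+(z-1)R(z)$. The assumption on the existence of $i\neq j$ is the condition under which the least squares problem has a unique solution. *)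

theory Defs
  imports Complex_Main
begin

end

theory Submission
  imports Defs
begin

text \<open>
  Put \<open>w\<^sub>i = 1 - z\<^sub>i \<ge> 1\<close>, so that \<open>R\<close> becomes an affine function \<open>v \<mapsto> a + b v\<close> of \<open>v = 1 - z\<close>
  and, the weights \<open>\<eta>\<^sub>i\<^sup>2\<close> being equal and positive, \<open>(a, b)\<close> is the ordinary least squares fit of
  the constant \<open>1\<close> by \<open>a w + b w\<^sup>2\<close> on the nodes \<open>w\<^sub>i\<close>.  Solving the two normal equations by
  Cramer's rule and symmetrizing every determinant over pairs of nodes expresses the value at \<open>v\<close>
  as the quotient of
  \<open>\<Sum>\<^sub>i\<^sub>j g\<^sub>i\<^sub>j (w\<^sub>i + w\<^sub>j - v)\<close> by the positive number
  \<open>\<Sum>\<^sub>i\<^sub>j g\<^sub>i\<^sub>j w\<^sub>i w\<^sub>j\<close>, with weights \<open>g\<^sub>i\<^sub>j = w\<^sub>i w\<^sub>j (w\<^sub>i - w\<^sub>j)\<^sup>2 \<ge> 0\<close>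
  (lemma \<open>normal_equations_cramer\<close>).

  The upper bound is then termwise:
  \<open>w\<^sub>i w\<^sub>j - (w\<^sub>i + w\<^sub>j - v) = (w\<^sub>i - 1) (w\<^sub>j - 1) + (v - 1) \<ge> 0\<close>.

  For the lower bound only the largest node \<open>v = W = w\<^sub>n\<close> matters, since the pair sum decreases in \<open>v\<close>.
  To the sum of numerator and denominator, which has to be nonnegative, the pair \<open>(i, j)\<close>
  contributes \<open>g\<^sub>i\<^sub>j ((1 + w\<^sub>i) (1 + w\<^sub>j) - (1 + W))\<close>, which may be
  negative.  The pairs containing \<open>n\<close>, however, contribute the large positive amounts
  \<open>W (W + 1) w\<^sub>i\<^sup>2 (W - w\<^sub>i)\<^sup>2\<close>, and there is one of them for each of the other \<open>n - 1\<close> nodes.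
  So it suffices that \<open>n - 1\<close> times the deficit of a single pair \<open>w\<^sub>i \<le> w\<^sub>j\<close> is at most the
  contribution of the pair \<open>(j, n)\<close>.  This holds by the arithmetic-geometric mean inequality when
  \<open>n \<le> 576\<close> or \<open>n \<le> 4 W\<^sup>2\<close> (lemma \<open>deficit_le_max_pair\<close>).  Case (i) is covered
  by the first alternative; in case (ii), \<open>\<surd>n \<le> W + 9\<close> and \<open>\<surd>n > 20\<close>, hence
  \<open>W > 11\<close> and \<open>\<surd>n \<le> 2 W\<close>.
\<close>

section \<open>Normal equations and Cramer's rule over pairs of nodes\<close>

text \<open>
  This is \<open>x y\<close> times the square of the Vandermonde determinant of \<open>x, y\<close>; it is the factor
  common to the terms of all symmetrized \<open>2 \<times> 2\<close> determinants of power sums below.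
\<close>

definition pair_weight :: "real \<Rightarrow> real \<Rightarrow> real" where
  "pair_weight x y = x * y * (x - y)\<^sup>2"

lemma pair_weight_nonneg: "0 \<le> x \<Longrightarrow> 0 \<le> y \<Longrightarrow> 0 \<le> pair_weight x y"
  by (simp add: pair_weight_def)

lemma pair_weight_commute: "pair_weight x y = pair_weight y x"
  by (simp add: pair_weight_def power2_commute mult.commute)

lemma pair_weight_self [simp]: "pair_weight x x = 0"
  by (simp add: pair_weight_def)

text \<open>
  Near \<open>e = 0\<close> a nonzero linear term would dominate the quadratic one and change sign with \<open>e\<close>.
  Applied along lines through a minimizer, this yields the normal equations.
\<close>

lemma linear_coeff_zero_if_nonneg:
  fixes l q :: real
  assumes "\<And>e. 0 \<le> 2 * e * l + e\<^sup>2 * q"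
  shows "l = 0"
proof (rule ccontr)
  assume "l \<noteq> 0"
  \<comment> \<open>At this point the quadratic term is smaller in absolute value than the linear one.\<close>
  define e where "e = - l / (\<bar>q\<bar> + 1)"
  have "e * (\<bar>q\<bar> + 1) = - l"
    by (simp add: e_def add_nonneg_eq_0_iff)
  then have "2 * e * l + e\<^sup>2 * q = e\<^sup>2 * (q - 2 * \<bar>q\<bar> - 2)"
    by (simp add: power2_eq_square) algebra
  also have "\<dots> < 0"
  proof (rule mult_pos_neg)
    have "e \<noteq> 0"
      using \<open>l \<noteq> 0\<close> by (simp add: e_def add_nonneg_eq_0_iff)
    then show "0 < e\<^sup>2"
      by simp
    show "q - 2 * \<bar>q\<bar> - 2 < 0"
      by linarith
  qed
  finally show False
    using assms[of e] by linarith
qed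

lemma least_squares_orthogonality:
  fixes p u :: "'i \<Rightarrow> real"
  assumes "\<And>e. (\<Sum>i\<in>A. (p i)\<^sup>2) \<le> (\<Sum>i\<in>A. (p i + e * u i)\<^sup>2)"
  shows "(\<Sum>i\<in>A. p i * u i) = 0"
proof (rule linear_coeff_zero_if_nonneg)
  fix e
  have "(\<Sum>i\<in>A. (p i + e * u i)\<^sup>2)
      = (\<Sum>i\<in>A. (p i)\<^sup>2) + 2 * e * (\<Sum>i\<in>A. p i * u i) + e\<^sup>2 * (\<Sum>i\<in>A. (u i)\<^sup>2)"
    by (simp add: power2_sum power_mult_distrib sum.distrib sum_distrib_left algebra_simps)
  then show "0 \<le> 2 * e * (\<Sum>i\<in>A. p i * u i) + e\<^sup>2 * (\<Sum>i\<in>A. (u i)\<^sup>2)"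
    using assms[of e] by linarith
qed

text \<open>
  With \<open>S\<^sub>k = \<Sum>\<^sub>i w\<^sub>i\<^sup>k\<close> the normal equations read \<open>a S\<^sub>2 + b S\<^sub>3 = S\<^sub>1\<close>,
  \<open>a S\<^sub>3 + b S\<^sub>4 = S\<^sub>2\<close>.  Hence, by Cramer's rule, \<open>(S\<^sub>2 S\<^sub>4 - S\<^sub>3\<^sup>2) (a + b v)\<close> is
  \<open>(S\<^sub>1 S\<^sub>4 - S\<^sub>2 S\<^sub>3) - v (S\<^sub>1 S\<^sub>3 - S\<^sub>2\<^sup>2)\<close>, and each determinant
  is half of a sum over pairs of nodes.
\<close>

lemma normal_equations_cramer:
  fixes w :: "'i \<Rightarrow> real" and a b v :: real
  assumes eq1: "(\<Sum>i\<in>A. w i * (1 - w i * (a + b * w i))) = 0"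
    and eq2: "(\<Sum>i\<in>A. (w i)\<^sup>2 * (1 - w i * (a + b * w i))) = 0"
  shows "(\<Sum>i\<in>A. \<Sum>j\<in>A. pair_weight (w i) (w j) * (w i * w j)) * (a + b * v)
       = (\<Sum>i\<in>A. \<Sum>j\<in>A. pair_weight (w i) (w j) * (w i + w j - v))"
proof -
  define S where "S k = (\<Sum>i\<in>A. w i ^ k)" for k
  have prod: "S k * S l = (\<Sum>i\<in>A. \<Sum>j\<in>A. w i ^ k * w j ^ l)" for k l
    by (simp add: S_def sum_product)
  have n1: "S 1 = a * S 2 + b * S 3"
    using eq1 by (simp add: S_def sum_subtractf sum.distrib sum_distrib_left algebra_simps
        power2_eq_square power3_eq_cube)
  have n2: "S 2 = a * S 3 + b * S 4"
    using eq2 by (simp add: S_def sum_subtractf sum.distrib sum_distrib_left algebra_simps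
        power2_eq_square power3_eq_cube power4_eq_xxxx)
  have "(\<Sum>i\<in>A. \<Sum>j\<in>A. pair_weight (w i) (w j) * (w i * w j))
      = (\<Sum>i\<in>A. \<Sum>j\<in>A. w i ^ 4 * w j ^ 2 + w i ^ 2 * w j ^ 4 - 2 * (w i ^ 3 * w j ^ 3))"
    by (intro sum.cong refl) (simp add: pair_weight_def, algebra)
  also have "\<dots> = S 4 * S 2 + S 2 * S 4 - 2 * (S 3 * S 3)"
    by (simp only: prod sum.distrib sum_subtractf sum_distrib_left)
  finally have d: "(\<Sum>i\<in>A. \<Sum>j\<in>A. pair_weight (w i) (w j) * (w i * w j))
      = S 4 * S 2 + S 2 * S 4 - 2 * (S 3 * S 3)" .
  have "(\<Sum>i\<in>A. \<Sum>j\<in>A. pair_weight (w i) (w j) * (w i + w j - v))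
      = (\<Sum>i\<in>A. \<Sum>j\<in>A. w i ^ 4 * w j ^ 1 + w i ^ 1 * w j ^ 4
           - (w i ^ 3 * w j ^ 2 + w i ^ 2 * w j ^ 3)
           - v * (w i ^ 3 * w j ^ 1 + w i ^ 1 * w j ^ 3 - 2 * (w i ^ 2 * w j ^ 2)))"
    by (intro sum.cong refl) (simp add: pair_weight_def, algebra)
  also have "\<dots> = S 4 * S 1 + S 1 * S 4 - (S 3 * S 2 + S 2 * S 3)
       - v * (S 3 * S 1 + S 1 * S 3 - 2 * (S 2 * S 2))"
    by (simp only: prod sum.distrib sum_subtractf sum_distrib_left[symmetric])
  also have "\<dots> = (S 4 * S 2 + S 2 * S 4 - 2 * (S 3 * S 3)) * (a + b * v)"
    using n1 n2 by algebra
  finally show ?thesis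
    using d by simp
qed

text \<open>
  The determinant is positive as soon as two nodes differ, because the pair they form contributes.
\<close>

lemma pair_determinant_pos:
  fixes w :: "'i \<Rightarrow> real"
  assumes "finite A" and pos: "\<And>i. i \<in> A \<Longrightarrow> 0 < w i"
    and "k \<in> A" "l \<in> A" "w k \<noteq> w l"
  shows "0 < (\<Sum>i\<in>A. \<Sum>j\<in>A. pair_weight (w i) (w j) * (w i * w j))"
proof -
  have nonneg: "0 \<le> pair_weight (w i) (w j) * (w i * w j)" if "i \<in> A" "j \<in> A" for i j
    using pos[OF that(1)] pos[OF that(2)] by (simp add: pair_weight_nonneg)
  have "0 < pair_weight (w k) (w l) * (w k * w l)"
    using assms by (simp add: pair_weight_def)
  then have "0 < (\<Sum>j\<in>A. pair_weight (w k) (w j) * (w k * w j))"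
    using nonneg \<open>k \<in> A\<close> \<open>l \<in> A\<close> \<open>finite A\<close> by (intro sum_pos2[of _ l]) auto
  then show ?thesis
    using nonneg \<open>k \<in> A\<close> \<open>finite A\<close>
    by (intro sum_pos2[of A k "\<lambda>i. \<Sum>j\<in>A. _ i j"]) (auto intro: sum_nonneg)
qed

section \<open>The deficit of a pair\<close>

text \<open>
  The elementary estimate behind the number \<open>576 = 8 \<cdot> 9 \<cdot> 8\<close>.  A negative contribution of the
  pair \<open>x \<le> y\<close> forces \<open>W > 1 + 2 y\<close>; with \<open>t = y - 1\<close> the right-hand side is then at least
  \<open>8 (t + 1) (2 t + 3) (t + 2)\<^sup>2\<close>, where \<open>(t + 1) (2 t + 3) \<ge> 9 t\<close> and \<open>(t + 2)\<^sup>2 \<ge> 8 t\<close>.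
\<close>

lemma square_bound_of_deficit:
  fixes y W N :: real
  assumes y: "1 \<le> y" and W: "1 + 2 * y \<le> W" and N: "N \<le> 576 \<or> N \<le> 4 * W\<^sup>2"
  shows "N * (y - 1)\<^sup>2 \<le> 4 * W * (W + 1) * (y * (y + 1))"
  using N
proof
  assume "N \<le> 4 * W\<^sup>2"
  then have "N * (y - 1)\<^sup>2 \<le> 4 * W\<^sup>2 * (y - 1)\<^sup>2"
    by (intro mult_right_mono) auto
  also have "\<dots> = 4 * W * W * (y - 1)\<^sup>2"
    by (simp add: power2_eq_square)
  also have "\<dots> \<le> 4 * W * (W + 1) * (y * (y + 1))"
  proof (rule mult_mono)
    have "(y - 1)\<^sup>2 = y * (y + 1) - (3 * y - 1)"
      by algebra
    then show "(y - 1)\<^sup>2 \<le> y * (y + 1)"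
      using y by linarith
  qed (use y W in auto)
  finally show ?thesis .
next
  assume N: "N \<le> 576"
  define t where "t = y - 1"
  have t: "0 \<le> t" and y_eq: "y = t + 1"
    using y by (auto simp: t_def)
  have q1: "9 * t \<le> (t + 1) * (2 * t + 3)"
  proof -
    have "(t + 1) * (2 * t + 3) - 9 * t = 2 * (t - 1)\<^sup>2 + 1"
      by algebra
    then show ?thesis
      by (smt (verit) zero_le_power2)
  qed
  have q2: "8 * t \<le> (t + 2)\<^sup>2"
  proof -
    have "(t + 2)\<^sup>2 - 8 * t = (t - 2)\<^sup>2"
      by algebra
    then show ?thesis
      by (smt (verit) zero_le_power2)
  qed
  have "N * (y - 1)\<^sup>2 \<le> 576 * t\<^sup>2"
    using N by (auto simp: t_def intro: mult_right_mono)
  also have "\<dots> = 8 * ((9 * t) * (8 * t))"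
    by (simp add: power2_eq_square)
  also have "\<dots> \<le> 8 * (((t + 1) * (2 * t + 3)) * (t + 2)\<^sup>2)"
    using t by (intro mult_left_mono mult_mono[OF q1 q2]) auto
  also have "\<dots> = 4 * ((2 * t + 3) * (2 * t + 4)) * (y * (y + 1))"
    unfolding y_eq by algebra
  also have "\<dots> \<le> 4 * (W * (W + 1)) * (y * (y + 1))"
    using t W unfolding y_eq by (intro mult_right_mono mult_left_mono mult_mono) auto
  finally show ?thesis
    by (simp add: mult.assoc)
qed

text \<open>
  The deficit of the pair \<open>x \<le> y\<close> is a multiple of \<open>(1 + y) x\<close> times \<open>(W - y) - (1 + y) x\<close>, and
  the product of two numbers with sum \<open>W - y\<close> is at most \<open>(W - y)\<^sup>2 / 4\<close>.  This produces exactly the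
  factor \<open>(W - y)\<^sup>2\<close> of the contribution of the pair \<open>(y, W)\<close>.
\<close>

lemma deficit_le_max_pair:
  fixes x y W N :: real
  assumes x: "1 \<le> x" and xy: "x \<le> y" and yW: "y \<le> W"
    and N0: "0 \<le> N" and N: "N \<le> 576 \<or> N \<le> 4 * W\<^sup>2"
  shows "N * (pair_weight x y * (W - x - y - x * y)) \<le> pair_weight y W * (y + y * W)"
proof (cases "W - x - y - x * y \<le> 0")
  case True
  then have "N * (pair_weight x y * (W - x - y - x * y)) \<le> 0"
    using N0 x xy by (intro mult_nonneg_nonpos pair_weight_nonneg) auto
  also have "0 \<le> pair_weight y W * (y + y * W)"
    using x xy yW by (intro mult_nonneg_nonneg pair_weight_nonneg add_nonneg_nonneg) auto
  finally show ?thesis .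
next
  case False
  have "y \<le> x * y"
    using x xy by simp
  then have W: "1 + 2 * y \<le> W"
    using False x by linarith
  have amgm: "4 * ((1 + y) * x) * (W - x - y - x * y) \<le> (W - y)\<^sup>2"
  proof -
    have "(W - y)\<^sup>2 - 4 * ((1 + y) * x) * (W - x - y - x * y) = (W - y - 2 * ((1 + y) * x))\<^sup>2"
      by algebra
    then show ?thesis
      by (smt (verit) zero_le_power2)
  qed
  have "N * (y - x)\<^sup>2 \<le> N * (y - 1)\<^sup>2"
    using N0 x xy by (intro mult_left_mono power_mono) auto
  also have "\<dots> \<le> 4 * W * (W + 1) * (y * (y + 1))"
    using x xy W N by (intro square_bound_of_deficit) auto
  finally have sq: "N * (y - x)\<^sup>2 \<le> 4 * W * (W + 1) * (y * (y + 1))" .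
  have "(4 * (1 + y)) * (N * (pair_weight x y * (W - x - y - x * y)))
      = (N * (y - x)\<^sup>2) * (y * (4 * ((1 + y) * x) * (W - x - y - x * y)))"
    unfolding pair_weight_def by algebra
  also have "\<dots> \<le> (N * (y - x)\<^sup>2) * (y * (W - y)\<^sup>2)"
    using amgm N0 x xy by (intro mult_left_mono) auto
  also have "\<dots> \<le> (4 * W * (W + 1) * (y * (y + 1))) * (y * (W - y)\<^sup>2)"
    using sq x xy by (intro mult_right_mono) auto
  also have "\<dots> = (4 * (1 + y)) * (pair_weight y W * (y + y * W))"
    unfolding pair_weight_def by algebra
  finally show ?thesis
    using x xy by (simp add: mult_le_cancel_left)
qed

text \<open>
  The node \<open>W\<close> is split off from the others, which are the \<open>w i\<close> with \<open>i \<in> A\<close>.  Bounding the deficit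
  of each pair by the \<^emph>\<open>sum\<close> of the two contributions with \<open>W\<close> makes the bound symmetric;
  summed over all ordered pairs, every contribution is counted \<open>2 card A\<close> times.
\<close>

lemma pair_sum_nonneg:
  fixes w :: "'i \<Rightarrow> real" and W :: real
  assumes "finite A" "A \<noteq> {}" and w: "\<And>i. i \<in> A \<Longrightarrow> 1 \<le> w i \<and> w i \<le> W"
    and N: "real (card A) \<le> 576 \<or> real (card A) \<le> 4 * W\<^sup>2"
  shows "0 \<le> 2 * (\<Sum>i\<in>A. pair_weight (w i) W * (w i + w i * W))
           + (\<Sum>i\<in>A. \<Sum>j\<in>A. pair_weight (w i) (w j) * (w i + w j + w i * w j - W))"
proof -
  define c where "c i = pair_weight (w i) W * (w i + w i * W)" for i
  define N where "N = real (card A)"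
  have "0 < N"
    using assms(1,2) by (simp add: N_def card_gt_0_iff)
  have c: "0 \<le> c i" if "i \<in> A" for i
    using w[OF that] unfolding c_def
    by (intro mult_nonneg_nonneg pair_weight_nonneg add_nonneg_nonneg) auto
  have ordered: "N * (pair_weight (w i) (w j) * (W - w i - w j - w i * w j)) \<le> c j"
    if "i \<in> A" "j \<in> A" "w i \<le> w j" for i j
    using w[OF that(1)] w[OF that(2)] that(3) \<open>0 < N\<close> N unfolding c_def N_def
    by (intro deficit_le_max_pair) auto
  have pair: "0 \<le> N * (pair_weight (w i) (w j) * (w i + w j + w i * w j - W)) + (c i + c j)"
    if ij: "i \<in> A" "j \<in> A" for i j
  proof (cases "w i \<le> w j")
    case True
    show ?thesis
      using ordered[OF ij True] c[OF ij(1)] by (simp add: algebra_simps)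
  next
    case False
    then show ?thesis
      using ordered[OF ij(2,1)] c[OF ij(2)]
      by (simp add: algebra_simps pair_weight_commute[of "w j" "w i"])
  qed
  have "0 \<le> (\<Sum>i\<in>A. \<Sum>j\<in>A.
      N * (pair_weight (w i) (w j) * (w i + w j + w i * w j - W)) + (c i + c j))"
    using pair by (intro sum_nonneg) auto
  also have "\<dots> = N * (2 * (\<Sum>i\<in>A. c i)
      + (\<Sum>i\<in>A. \<Sum>j\<in>A. pair_weight (w i) (w j) * (w i + w j + w i * w j - W)))"
    by (simp add: sum.distrib sum_distrib_left[symmetric] N_def distrib_left)
  finally show ?thesis
    using \<open>0 < N\<close> unfolding c_def by (simp add: zero_le_mult_iff)
qed

section \<open>Bounds for the fitted function\<close>

text \<open>
  Multiplied by the determinant, both sides become pair sums, and these compare term by term because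
  \<open>(w i - 1) (w j - 1)\<close> and \<open>v - 1\<close> are nonnegative.
\<close>

lemma fit_le_one:
  fixes w :: "'i \<Rightarrow> real" and a b v :: real
  assumes "finite A" and w: "\<And>i. i \<in> A \<Longrightarrow> 1 \<le> w i"
    and kl: "k \<in> A" "l \<in> A" "w k \<noteq> w l" and v: "1 \<le> v"
    and eq1: "(\<Sum>i\<in>A. w i * (1 - w i * (a + b * w i))) = 0"
    and eq2: "(\<Sum>i\<in>A. (w i)\<^sup>2 * (1 - w i * (a + b * w i))) = 0"
  shows "a + b * v \<le> 1"
proof -
  define D where "D = (\<Sum>i\<in>A. \<Sum>j\<in>A. pair_weight (w i) (w j) * (w i * w j))"
  have "0 < w i" if "i \<in> A" for i
    using w[OF that] by linarith
  then have D: "0 < D"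
    unfolding D_def using \<open>finite A\<close> kl by (intro pair_determinant_pos) auto
  have "D * (a + b * v) = (\<Sum>i\<in>A. \<Sum>j\<in>A. pair_weight (w i) (w j) * (w i + w j - v))"
    unfolding D_def using eq1 eq2 by (rule normal_equations_cramer)
  also have "\<dots> \<le> D"
    unfolding D_def
  proof (intro sum_mono mult_left_mono)
    fix i j assume ij: "i \<in> A" "j \<in> A"
    have "0 \<le> (w i - 1) * (w j - 1)"
      using w ij by simp
    then show "w i + w j - v \<le> w i * w j"
      using v by (simp add: algebra_simps)
    show "0 \<le> pair_weight (w i) (w j)"
      using w[OF ij(1)] w[OF ij(2)] by (intro pair_weight_nonneg) auto
  qed
  finally show ?thesis
    using D by simp
qed

text \<open>
  Here the terms do not compare one by one: after \<open>v\<close> is replaced by the largest node \<open>w m\<close>, the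
  pairs without \<open>m\<close> have to borrow from those with \<open>m\<close>.
\<close>

lemma fit_ge_minus_one:
  fixes w :: "'i \<Rightarrow> real" and a b v :: real
  assumes "finite A" and m: "m \<in> A" and w: "\<And>i. i \<in> A \<Longrightarrow> 1 \<le> w i \<and> w i \<le> w m"
    and kl: "k \<in> A" "l \<in> A" "w k \<noteq> w l" and v: "v \<le> w m"
    and N: "real (card A) \<le> 576 \<or> real (card A) \<le> 4 * (w m)\<^sup>2"
    and eq1: "(\<Sum>i\<in>A. w i * (1 - w i * (a + b * w i))) = 0"
    and eq2: "(\<Sum>i\<in>A. (w i)\<^sup>2 * (1 - w i * (a + b * w i))) = 0"
  shows "- 1 \<le> a + b * v"
proof -
  define D where "D = (\<Sum>i\<in>A. \<Sum>j\<in>A. pair_weight (w i) (w j) * (w i * w j))"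
  define B where "B = A - {m}"
  have A: "A = insert m B" and B: "finite B" "m \<notin> B"
    using m \<open>finite A\<close> by (auto simp: B_def)
  have "0 < w i" if "i \<in> A" for i
    using w[OF that] by linarith
  then have D: "0 < D"
    unfolding D_def using \<open>finite A\<close> kl by (intro pair_determinant_pos) auto
  have "B \<noteq> {}"
    using kl A by auto
  have "card B \<le> card A"
    using A \<open>finite A\<close> by (intro card_mono) auto
  then have NB: "real (card B) \<le> 576 \<or> real (card B) \<le> 4 * (w m)\<^sup>2"
    using N by linarith
  let ?g = "\<lambda>i j. pair_weight (w i) (w j) * (w i + w j + w i * w j - w m)"
  have "0 \<le> 2 * (\<Sum>i\<in>B. pair_weight (w i) (w m) * (w i + w i * w m)) + (\<Sum>i\<in>B. \<Sum>j\<in>B. ?g i j)"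
    using B \<open>B \<noteq> {}\<close> w A NB by (intro pair_sum_nonneg) auto
  also have "\<dots> = (\<Sum>i\<in>A. \<Sum>j\<in>A. ?g i j)"
  proof -
    have "?g i m = pair_weight (w i) (w m) * (w i + w i * w m)"
      "?g m i = pair_weight (w i) (w m) * (w i + w i * w m)" for i
      by (simp_all add: pair_weight_commute[of "w m" "w i"] algebra_simps)
    moreover have "(\<Sum>i\<in>A. \<Sum>j\<in>A. h i j)
        = h m m + (\<Sum>j\<in>B. h m j) + ((\<Sum>i\<in>B. h i m) + (\<Sum>i\<in>B. \<Sum>j\<in>B. h i j))"
      for h :: "'i \<Rightarrow> 'i \<Rightarrow> real"
      unfolding A using B by (simp add: sum.distrib)
    ultimately show ?thesis
      by simp
  qed
  also have "\<dots> \<le> (\<Sum>i\<in>A. \<Sum>j\<in>A. pair_weight (w i) (w j) * (w i + w j + w i * w j - v))"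
  proof (intro sum_mono mult_left_mono)
    fix i j assume ij: "i \<in> A" "j \<in> A"
    show "w i + w j + w i * w j - w m \<le> w i + w j + w i * w j - v"
      using v by simp
    show "0 \<le> pair_weight (w i) (w j)"
      using w[OF ij(1)] w[OF ij(2)] by (intro pair_weight_nonneg) auto
  qed
  also have "\<dots> = D + (\<Sum>i\<in>A. \<Sum>j\<in>A. pair_weight (w i) (w j) * (w i + w j - v))"
    unfolding D_def by (simp add: sum.distrib[symmetric] algebra_simps)
  also have "\<dots> = D + D * (a + b * v)"
    unfolding D_def using normal_equations_cramer[OF eq1 eq2] by simp
  finally have "0 \<le> D * (1 + (a + b * v))"
    by (simp add: distrib_left)
  then show ?thesis
    using D by (simp add: zero_le_mult_iff)
qed

theorem corollary2:
  fixes n :: nat and z \<eta> :: "nat \<Rightarrow> real" and \<alpha> \<beta> :: real and R :: "real \<Rightarrow> real"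
  assumes z_nonpos: "z 1 \<le> 0"
    and z_decreasing: "antimono_on {1..n} z"
    and equal_abs: "\<forall>i\<in>{1..n}. \<forall>j\<in>{1..n}. \<bar>\<eta> i\<bar> = \<bar>\<eta> j\<bar>"
    and nondegenerate: "\<exists>i\<in>{1..n}. \<exists>j\<in>{1..n}. i \<noteq> j \<and> z i \<noteq> z j \<and> z i \<noteq> 1 \<and> z j \<noteq> 1 \<and> \<eta> i * \<eta> j \<noteq> 0"
    and minimizer:
      "is_arg_min
         (\<lambda>(\<alpha>', \<beta>'). \<Sum>i = 1..n. (\<eta> i)\<^sup>2 * (1 + (z i - 1) * (\<alpha>' + \<beta>' * z i))\<^sup>2)
         (\<lambda>_ :: real \<times> real. True) (\<alpha>, \<beta>)"
    and R: "\<And>x. R x = \<alpha> + \<beta> * x"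
    and cases: "n \<le> 415 \<or> (n > 415 \<and> z n \<le> 10 - sqrt (real n))"
  shows "\<forall>i\<in>{1..n}. \<bar>R (z i)\<bar> \<le> 1"
proof
  fix k assume k: "k \<in> {1..n}"
  define w where "w i = 1 - z i" for i
  obtain p q where pq: "p \<in> {1..n}" "q \<in> {1..n}" "z p \<noteq> z q" "\<eta> p \<noteq> 0"
    using nondegenerate by auto
  have n: "n \<in> {1..n}"
    using k by simp
  have w: "1 \<le> w i \<and> w i \<le> w n" if "i \<in> {1..n}" for i
  proof -
    have "z i \<le> z 1" "z n \<le> z i"
      using that monotone_onD[OF z_decreasing, of 1 i] monotone_onD[OF z_decreasing, of i n] by auto
    then show ?thesis
      using z_nonpos by (simp add: w_def)
  qed
  have sq: "(\<eta> i)\<^sup>2 = (\<eta> p)\<^sup>2" if "i \<in> {1..n}" for i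
  proof -
    have "\<bar>\<eta> i\<bar> = \<bar>\<eta> p\<bar>"
      using equal_abs that pq(1) by blast
    then show ?thesis
      by (metis power2_abs)
  qed
  define f where "f s t i = 1 + (z i - 1) * (s + t * z i)" for s t i
  have min: "(\<Sum>i = 1..n. (f \<alpha> \<beta> i)\<^sup>2) \<le> (\<Sum>i = 1..n. (f s t i)\<^sup>2)" for s t
  proof -
    have scale: "(\<Sum>i = 1..n. (\<eta> i)\<^sup>2 * (f s t i)\<^sup>2) = (\<eta> p)\<^sup>2 * (\<Sum>i = 1..n. (f s t i)\<^sup>2)" for s t
      unfolding sum_distrib_left by (intro sum.cong refl) (simp add: sq)
    have "(\<Sum>i = 1..n. (\<eta> i)\<^sup>2 * (f \<alpha> \<beta> i)\<^sup>2) \<le> (\<Sum>i = 1..n. (\<eta> i)\<^sup>2 * (f s t i)\<^sup>2)"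
      using minimizer unfolding is_arg_min_linorder f_def by auto
    then show ?thesis
      using pq(4) unfolding scale by simp
  qed
  have f_eq: "f \<alpha> \<beta> i = 1 - w i * ((\<alpha> + \<beta>) + (- \<beta>) * w i)" for i
    unfolding f_def w_def by algebra
  \<comment> \<open>Moving \<open>(\<alpha>, \<beta>)\<close> in the directions \<open>(-1, 0)\<close> and \<open>(-1, 1)\<close> changes the residual by
    multiples of \<open>w\<close> and of \<open>w\<^sup>2\<close>.\<close>
  have "(\<Sum>i = 1..n. f \<alpha> \<beta> i * w i) = 0"
  proof (rule least_squares_orthogonality)
    fix e
    have "f (\<alpha> - e) \<beta> i = f \<alpha> \<beta> i + e * w i" for i
      unfolding f_def w_def by algebra
    then show "(\<Sum>i = 1..n. (f \<alpha> \<beta> i)\<^sup>2) \<le> (\<Sum>i = 1..n. (f \<alpha> \<beta> i + e * w i)\<^sup>2)"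
      using min[of "\<alpha> - e" \<beta>] by simp
  qed
  then have eq1: "(\<Sum>i = 1..n. w i * (1 - w i * ((\<alpha> + \<beta>) + (- \<beta>) * w i))) = 0"
    by (simp only: f_eq mult.commute)
  have "(\<Sum>i = 1..n. f \<alpha> \<beta> i * (w i)\<^sup>2) = 0"
  proof (rule least_squares_orthogonality)
    fix e
    have "f (\<alpha> - e) (\<beta> + e) i = f \<alpha> \<beta> i + e * (w i)\<^sup>2" for i
      unfolding f_def w_def by algebra
    then show "(\<Sum>i = 1..n. (f \<alpha> \<beta> i)\<^sup>2) \<le> (\<Sum>i = 1..n. (f \<alpha> \<beta> i + e * (w i)\<^sup>2)\<^sup>2)"
      using min[of "\<alpha> - e" "\<beta> + e"] by simp
  qed
  then have eq2: "(\<Sum>i = 1..n. (w i)\<^sup>2 * (1 - w i * ((\<alpha> + \<beta>) + (- \<beta>) * w i))) = 0"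
    by (simp only: f_eq mult.commute)
  have size: "real (card {1..n}) \<le> 576 \<or> real (card {1..n}) \<le> 4 * (w n)\<^sup>2"
    using cases
  proof
    assume "n \<le> 415"
    then show ?thesis
      by simp
  next
    assume large: "n > 415 \<and> z n \<le> 10 - sqrt (real n)"
    have "20 < sqrt (real n)"
      using large by (intro real_less_rsqrt) auto
    moreover have "sqrt (real n) \<le> w n + 9"
      using large by (simp add: w_def)
    ultimately have "sqrt (real n) \<le> 2 * w n"
      by linarith
    then have "(sqrt (real n))\<^sup>2 \<le> (2 * w n)\<^sup>2"
      by (intro power_mono) auto
    then show ?thesis
      by (simp add: power_mult_distrib)
  qed
  have wpq: "w p \<noteq> w q"
    using pq(3) by (simp add: w_def)
  have "R (z k) = (\<alpha> + \<beta>) + (- \<beta>) * w k"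
    unfolding R w_def by algebra
  moreover have "(\<alpha> + \<beta>) + (- \<beta>) * w k \<le> 1"
    using w k by (intro fit_le_one[OF _ _ pq(1,2) wpq _ eq1 eq2]) auto
  moreover have "- 1 \<le> (\<alpha> + \<beta>) + (- \<beta>) * w k"
    using w k by (intro fit_ge_minus_one[OF _ n _ pq(1,2) wpq _ size eq1 eq2]) auto
  ultimately show "\<bar>R (z k)\<bar> \<le> 1"
    by simp
qed

end
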